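(* Let $k\ge1$ and let $\alpha\in I^k=\{0,1\}^k$, $\alpha\ne 0$. Then to each partition $\xi=\{\alpha^1,\dots,\alpha^r\}\subseteq I^k$ of $\alpha$ one can associate (recursively defined) sets $\mathscr A^\xi_0,\mathscr A^\xi_{\alpha^1},\dots,\mathscr A^\xi_{\alpha^r}$ such that: 1. the sets $\mathscr A^\xi_0,\mathscr A^\xi_{\alpha^1},\dots,\mathscr A^\xi_{\alpha^r}$ are pairwise disjoint; 2. $\beta\in\mathscr A^\xi_\beta\subset[\alpha]$ for $\beta=0,\alpha^1,\dots,\alpha^r$; 3. $|\gamma|>|\beta|$ for every $\gamma\in\mathscr A^\xi_\beta\setminus\{\beta\}$ and $\beta=0,\alpha^1,\dots,\alpha^r$; and, for all linear spaces $X,Y,Z$, any maps $f:X\to Y$ and $g:Z\to X$, any multi-vector $u\in Z^k$ and any $x\in Z$, $$\Delta^\alpha_u (f\circ g)(x) = \sum_{\xi = \{\alpha^1,\ldots,\alpha^r\}\in \mathscr P_\alpha} \Delta^{r}_{ u^\xi_{\alpha^1},\ldots, u^\xi_{\alpha^r} } f(u^{\xi}_0),$$ where $u^{\xi}_\beta = \sum_{\gamma\in \mathscr A^\xi_\beta} \Delta^\gamma_u g(x)$ for each $\beta=0,\alpha^1,\dots,\alpha^r$.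
   Context: Notation: for $\alpha\in\mathbb N^k$ (with $0\in\mathbb N$), $|\alpha|=\alpha_1+\cdots+\alpha_k$; $\beta\le\alpha$ means $\beta_i\le\alpha_i$ for all $i$; $[\alpha]=\{\beta\in\mathbb N^k:\beta\le\alpha\}$. For $\alpha\in I^k=\{0,1\}^k$, a partition of $\alpha$ with size $r$ is a subset with $r$ elements $\{\alpha^1,\dots,\alpha^r\}\subseteq I^k\setminus\{0\}$ such that $\alpha^1+\cdots+\alpha^r=\alpha$; sizes range from $1$ to $|\alpha|$. $\mathscr P_\alpha$ is the set of all partitions of $\alpha$. For a function $f$ on a linear space $X$ and $u\in X$, $(\Delta_u f)(x)=f(x+u)-f(x)$. These operators commute. For $v_1,\dots,v_n\in X$, $\Delta^n_{v_1,\dots,v_n}=\Delta_{v_1}\circ\cdots\circ\Delta_{v_n}$. For $\alpha\in\mathbb N^k$ and $u=(u_1,\dots,u_k)\in X^k$, $\Delta^\alpha_u=(\Delta_{u_1})^{\alpha_1}\circ\cdots\circ(\Delta_{u_k})^{\alpha_k}$; in particular $\Delta^0_u g(x)=g(x)$. *)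

theory Defs
  imports
    Complex_Main
    "HOL-Library.Function_Algebras"
    "HOL-Library.Disjoint_Sets"
begin

(* A multi-index in N^k is a function on nat that vanishes outside {..<k} (coordinates are
   numbered 0,...,k-1).  Addition, 0 and the order of multi-indices are the pointwise ones. *)

type_synonym mindex = "nat \<Rightarrow> nat"

definition mindices :: "nat \<Rightarrow> mindex set" where
  "mindices k = {\<alpha>. \<forall>i\<ge>k. \<alpha> i = 0}"

definition cube :: "nat \<Rightarrow> mindex set" where
  "cube k = {\<alpha> \<in> mindices k. \<forall>i<k. \<alpha> i \<in> {0, 1}}"

definition msize :: "nat \<Rightarrow> mindex \<Rightarrow> nat" where
  "msize k \<alpha> = (\<Sum>i<k. \<alpha> i)"

definition mbox :: "nat \<Rightarrow> mindex \<Rightarrow> mindex set" where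
  "mbox k \<alpha> = {\<beta> \<in> mindices k. \<beta> \<le> \<alpha>}"

definition partitions :: "nat \<Rightarrow> mindex \<Rightarrow> mindex set set" where
  "partitions k \<alpha> = {\<xi>. \<xi> \<subseteq> cube k - {0} \<and> (\<Sum>\<beta>\<in>\<xi>. \<beta>) = \<alpha>}"

definition fdiff :: "'a::ab_group_add \<Rightarrow> ('a \<Rightarrow> 'b::ab_group_add) \<Rightarrow> 'a \<Rightarrow> 'b" where
  "fdiff u f x = f (x + u) - f x"

definition fdiffs :: "'a::ab_group_add list \<Rightarrow> ('a \<Rightarrow> 'b::ab_group_add) \<Rightarrow> 'a \<Rightarrow> 'b" where
  "fdiffs vs = foldr fdiff vs"

(* Only the entries u i with i < k of the multi-vector u are used. *)

definition mdiff ::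
  "nat \<Rightarrow> (nat \<Rightarrow> 'a::ab_group_add) \<Rightarrow> mindex \<Rightarrow> ('a \<Rightarrow> 'b::ab_group_add) \<Rightarrow> 'a \<Rightarrow> 'b" where
  "mdiff k u \<alpha> = foldr (\<lambda>i. fdiff (u i) ^^ \<alpha> i) [0..<k]"

(* The binary weight is injective on cube k and has its least value at 0.  It fixes the order in
   which the elements of a partition are taken in the recursion below. *)

definition weight :: "nat \<Rightarrow> mindex \<Rightarrow> nat" where
  "weight k \<beta> = (\<Sum>i<k. 2 ^ i * \<beta> i)"

(* Recursion on the number of coordinates: applying the difference operator in direction u k to
   the formula for the first k coordinates.  Let \<xi>' be the partition induced by \<xi> on the first k
   coordinates, and w \<beta> the vectors belonging to \<xi>'.  If some \<delta> in \<xi> has \<delta> k = 1, it extends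
   \<delta>' = \<delta>(k := 0), which is an element of \<xi>' or 0.  Telescope, over {0} Un \<xi>' in order of
   increasing weight, the change of each w \<beta> to w \<beta> + fdiff (u k) (w \<beta>); the summand in which
   w \<delta>' changes is the one belonging to \<xi>.  In it the \<beta> of smaller weight have changed already
   (so their sets also contain the translates by the k-th unit vector), those of larger weight
   have not.  For \<delta>' = 0 the change of the base point is a new direction; for \<delta>' \<noteq> 0 the identity
     fdiff (a + b) h y - fdiff a h y = fdiff b h (y + a)
   makes fdiff (u k) (w \<delta>') the direction belonging to \<delta>, and adds w \<delta>' to the base point.
   The values at \<beta> outside {0} Un \<xi> are irrelevant. *)

primrec chain_set :: "nat \<Rightarrow> mindex set \<Rightarrow> mindex \<Rightarrow> mindex set" where
  "chain_set 0 \<xi> \<beta> = {0}"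
| "chain_set (Suc k) \<xi> \<beta> =
    (let \<xi>' = (\<lambda>\<delta>. \<delta>(k := 0)) ` \<xi> - {0};
         A = chain_set k \<xi>';
         lift = (\<lambda>S. (\<lambda>\<gamma>. \<gamma>(k := 1)) ` S)
     in if \<beta> k = 1 then lift (A (\<beta>(k := 0)))
        else A \<beta> \<union>
          (\<Union>\<delta>\<in>{\<delta> \<in> \<xi>. \<delta> k = 1}.
             (if weight k \<beta> < weight k (\<delta>(k := 0)) then lift (A \<beta>) else {}) \<union>
             (if \<beta> = 0 then A (\<delta>(k := 0)) else {})))"

end

theory Submission
  imports Defs
begin

text \<open>
  The formula is a chain rule of Faa di Bruno type for finite differences, and it holds by
  induction on the number of coordinates. A coordinate in which \<open>\<alpha>\<close> vanishes changes nothing, so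
  let \<open>\<alpha> k = 1\<close>. By the formula for the first \<open>k\<close>
  coordinates, the function to which the last difference operator applies is a sum, over the
  partitions \<open>\<xi>\<close> of \<open>\<alpha>(k := 0)\<close>, of iterated differences \<open>F w\<close> of \<open>f\<close>, whose base point \<open>w 0\<close> and
  directions \<open>w \<beta>\<close>, \<open>\<beta> \<in> \<xi>\<close>, depend on \<open>x\<close>. Passing from \<open>x\<close> to \<open>x + u k\<close> replaces the family
  \<open>w = a\<close> by another family \<open>b\<close>, and \<open>F b - F a\<close> telescopes into one summand for every
  \<open>\<delta> \<in> insert 0 \<xi>\<close>, in which only the value at \<open>\<delta>\<close> changes (lemma \<open>telescope_by_rank\<close>). Each
  summand is again an iterated difference: a change of the base point by \<open>e\<close> is a difference in
  the new direction \<open>e\<close>, while for a direction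
  \<open>fdiff b h y - fdiff a h y = h (y + b) - h (y + a) = fdiff (b - a) h (y + a)\<close>,
  so that the change becomes the direction and the old direction moves into the base point (lemma
  \<open>single_change\<close>). The directions and the base point so obtained are the sums over the sets
  \<open>chain_set (Suc k)\<close> for the partition that arises from \<open>\<xi>\<close> by raising the last coordinate of
  \<open>\<delta>\<close>, the case \<open>\<delta> = 0\<close> standing for a new element, the last unit vector (lemma
  \<open>direction_extend\<close>).

  Every partition of \<open>\<alpha>\<close> arises in this way from exactly one pair \<open>(\<xi>, \<delta>)\<close>: its elements have
  disjoint supports, hence exactly one of them has last coordinate 1 (lemma \<open>bij_betw_extend\<close>).
  This bijection turns the double sum over \<open>\<xi>\<close> and \<open>\<delta>\<close> into the sum over the partitions of \<open>\<alpha>\<close>.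

  Disjointness, the inclusion in the box and the growth of the size pass from \<open>\<xi>\<close> to the
  extended partition by inspection of the recursion (lemma \<open>proper_chains_extend\<close>). The
  disjointness is also needed for the formula, because the vectors are sums over unions of sets.
\<close>

section \<open>Difference operators\<close>

lemma fdiff_commute: "fdiff a (fdiff b h) = fdiff b (fdiff a h)"
  by (simp add: fun_eq_iff fdiff_def add_ac algebra_simps)

lemma fdiff_funpow_commute: "(fdiff a ^^ n) (fdiff b h) = fdiff b ((fdiff a ^^ n) h)"
  by (induction n) (simp_all add: fdiff_commute)

lemma mdiff_0: "mdiff 0 u \<alpha> h = h"
  by (simp add: mdiff_def)

lemma mdiff_Suc: "mdiff (Suc k) u \<alpha> h = mdiff k u \<alpha> ((fdiff (u k) ^^ \<alpha> k) h)"
  by (simp add: mdiff_def)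

lemma mdiff_upd: "mdiff k u (\<alpha>(k := c)) h = mdiff k u \<alpha> h"
  unfolding mdiff_def by (rule foldr_cong) auto

lemma mdiff_fdiff: "mdiff k u \<alpha> (fdiff a h) = fdiff a (mdiff k u \<alpha> h)"
  by (induction k arbitrary: h) (simp_all add: mdiff_0 mdiff_Suc fdiff_funpow_commute)

lemma mdiff_Suc_0: "\<gamma> k = 0 \<Longrightarrow> mdiff (Suc k) u \<gamma> h = mdiff k u \<gamma> h"
  by (simp add: mdiff_Suc)

lemma mdiff_Suc_1:
  "\<gamma> k = 1 \<Longrightarrow> mdiff (Suc k) u \<gamma> h = fdiff (u k) (mdiff k u (\<gamma>(k := 0)) h)"
  by (simp add: mdiff_Suc mdiff_fdiff mdiff_upd)

text \<open>As difference operators commute, the directions may be indexed by a finite set instead of a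
  list. In this form the enumerations of the partitions of different numbers of coordinates need
  not be related to each other.\<close>
definition set_fdiffs ::
  "('i \<Rightarrow> 'a::ab_group_add) \<Rightarrow> 'i set \<Rightarrow> ('a \<Rightarrow> 'b::ab_group_add) \<Rightarrow> 'a \<Rightarrow> 'b" where
  "set_fdiffs v S f = Finite_Set.fold (\<lambda>\<beta>. fdiff (v \<beta>)) f S"

lemma set_fdiffs_empty [simp]: "set_fdiffs v {} f = f"
  by (simp add: set_fdiffs_def)

lemma set_fdiffs_insert:
  assumes "finite S" "\<beta> \<notin> S"
  shows "set_fdiffs v (insert \<beta> S) f = fdiff (v \<beta>) (set_fdiffs v S f)"
proof -
  interpret comp_fun_commute "\<lambda>\<beta>. fdiff (v \<beta>)"
    by unfold_locales (simp add: fun_eq_iff fdiff_commute)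
  show ?thesis
    using assms by (simp add: set_fdiffs_def fold_insert)
qed

lemma set_fdiffs_cong:
  assumes "finite S" "\<And>\<beta>. \<beta> \<in> S \<Longrightarrow> v \<beta> = w \<beta>"
  shows "set_fdiffs v S f = set_fdiffs w S f"
  using assms by (induction S rule: finite_induct) (simp_all add: set_fdiffs_insert)

lemma fdiffs_eq_set_fdiffs: "distinct xs \<Longrightarrow> fdiffs (map v xs) f = set_fdiffs v (set xs) f"
  by (induction xs) (simp_all add: fdiffs_def set_fdiffs_insert)

section \<open>Multi-indices\<close>

lemma cube_iff: "\<alpha> \<in> cube k \<longleftrightarrow> (\<forall>i. \<alpha> i \<le> 1) \<and> (\<forall>i\<ge>k. \<alpha> i = 0)"
proof -
  have "n \<in> {0, 1} \<longleftrightarrow> n \<le> 1" for n :: nat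
    by auto
  then show ?thesis
    unfolding cube_def mindices_def mem_Collect_eq
    by (metis le_less_linear le_zero_eq linorder_linear zero_le)
qed

lemma cube_upd_0: "\<alpha> \<in> cube (Suc k) \<Longrightarrow> \<alpha>(k := 0) \<in> cube k"
  by (auto simp: cube_iff)

lemma cube_upd_1: "\<alpha> \<in> cube k \<Longrightarrow> \<alpha>(k := 1) \<in> cube (Suc k)"
  by (auto simp: cube_iff)

lemma cube_mono: "\<alpha> \<in> cube k \<Longrightarrow> \<alpha> \<in> cube (Suc k)"
  by (auto simp: cube_iff)

lemma cube_top: "\<alpha> \<in> cube k \<Longrightarrow> \<alpha> k = 0"
  by (auto simp: cube_iff)

lemma zero_in_cube: "0 \<in> cube k"
  by (auto simp: cube_iff)

lemma finite_cube: "finite (cube k)"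
proof (induction k)
  case 0
  have "cube 0 \<subseteq> {0}" by (auto simp: cube_iff fun_eq_iff)
  then show ?case using finite_subset by blast
next
  case (Suc k)
  have "\<alpha> \<in> cube k \<union> (\<lambda>\<gamma>. \<gamma>(k := 1)) ` cube k" if "\<alpha> \<in> cube (Suc k)" for \<alpha>
  proof (cases "\<alpha> k = 0")
    case True
    then show ?thesis using cube_upd_0[OF that] by (simp add: fun_upd_idem)
  next
    case False
    then have "\<alpha> k = 1" using that by (simp add: cube_iff) (metis Suc_leI le_antisym)
    then have "\<alpha> = (\<alpha>(k := 0))(k := 1)" by (auto simp: fun_eq_iff)
    then show ?thesis using cube_upd_0[OF that] by blast
  qed
  then have "cube (Suc k) \<subseteq> cube k \<union> (\<lambda>\<gamma>. \<gamma>(k := 1)) ` cube k" by blast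
  then show ?case using Suc finite_subset by blast
qed

text \<open>The weight is a binary expansion, with digits 0 and 1 on the cube; hence this bound and
  the injectivity that follows from it.\<close>
lemma weight_less:
  assumes "\<alpha> \<in> cube k"
  shows "weight j \<alpha> < 2 ^ j"
proof (induction j)
  case 0
  show ?case by (simp add: weight_def)
next
  case (Suc j)
  have "\<alpha> j \<le> 1" using assms by (auto simp: cube_iff)
  then have "2 ^ j * \<alpha> j \<le> (2::nat) ^ j" by simp
  then have "2 ^ j * \<alpha> j + weight j \<alpha> < 2 ^ j + 2 ^ j" using Suc by linarith
  then show ?case by (simp add: weight_def)
qed

lemma weight_inj:
  assumes "\<alpha> \<in> cube k" "\<beta> \<in> cube k" "weight k \<alpha> = weight k \<beta>"
  shows "\<alpha> = \<beta>"
proof -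
  have "weight j \<alpha> = weight j \<beta> \<Longrightarrow> i < j \<Longrightarrow> \<alpha> i = \<beta> i" for i j
  proof (induction j)
    case (Suc j)
    have le: "\<alpha> j \<le> 1" "\<beta> j \<le> 1" using assms by (auto simp: cube_iff)
    have lt: "weight j \<alpha> < 2 ^ j" "weight j \<beta> < 2 ^ j"
      using weight_less assms by blast+
    have eq: "weight j \<alpha> + 2 ^ j * \<alpha> j = weight j \<beta> + 2 ^ j * \<beta> j"
      using Suc.prems(1) by (simp add: weight_def)
    have "\<alpha> j = \<beta> j" using le lt eq by (auto simp: le_Suc_eq)
    with eq Suc show ?case by (auto simp: less_Suc_eq)
  qed simp
  then have "\<forall>i<k. \<alpha> i = \<beta> i" using assms(3) by blast
  then show ?thesis using assms(1,2) by (auto simp: cube_iff fun_eq_iff) (metis not_le)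
qed

lemma weight_0 [simp]: "weight k 0 = 0"
  by (simp add: weight_def)

lemma msize_Suc: "msize (Suc k) \<gamma> = msize k \<gamma> + \<gamma> k"
  by (simp add: msize_def)

lemma msize_upd [simp]: "msize k (\<gamma>(k := c)) = msize k \<gamma>"
  by (simp add: msize_def)

lemma msize_pos:
  assumes "\<gamma> \<in> mindices k" "\<gamma> \<noteq> 0"
  shows "msize k \<gamma> > 0"
proof -
  have "\<exists>i. \<gamma> i \<noteq> 0" using assms(2) by (auto simp: fun_eq_iff)
  then obtain i where i: "\<gamma> i \<noteq> 0" ..
  have "\<gamma> i = 0" if "k \<le> i" using assms(1) that by (simp add: mindices_def)
  with i have "i < k" by linarith
  then have "\<gamma> i \<le> msize k \<gamma>" unfolding msize_def by (intro member_le_sum) auto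
  then show ?thesis using i by simp
qed

lemma sum_fun_apply: "(\<Sum>\<beta>\<in>S. h \<beta>) i = (\<Sum>\<beta>\<in>S. h \<beta> i)"
  by (induction S rule: infinite_finite_induct) auto

section \<open>Partitions\<close>

lemma partitions_subset: "\<xi> \<in> partitions k \<alpha> \<Longrightarrow> \<xi> \<subseteq> cube k - {0}"
  by (auto simp: partitions_def)

lemma partitions_insert0_subset: "\<xi> \<in> partitions k \<alpha> \<Longrightarrow> insert 0 \<xi> \<subseteq> cube k"
  using partitions_subset zero_in_cube by blast

lemma partitions_finite: "\<xi> \<in> partitions k \<alpha> \<Longrightarrow> finite \<xi>"
  using partitions_subset finite_cube by (meson finite_Diff finite_subset)

lemma partitions_sum: "\<xi> \<in> partitions k \<alpha> \<Longrightarrow> (\<Sum>\<beta>\<in>\<xi>. \<beta> i) = \<alpha> i"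
  using sum_fun_apply[of "\<lambda>\<beta>. \<beta>" \<xi> i] by (simp add: partitions_def)

lemma finite_partitions: "finite (partitions k \<alpha>)"
proof -
  have "partitions k \<alpha> \<subseteq> Pow (cube k)" by (auto simp: partitions_def)
  then show ?thesis using finite_cube finite_subset by blast
qed

lemma partitionsI:
  assumes "\<xi> \<subseteq> cube k - {0}" "\<And>i. (\<Sum>\<beta>\<in>\<xi>. \<beta> i) = \<alpha> i"
  shows "\<xi> \<in> partitions k \<alpha>"
  using assms by (auto simp: partitions_def fun_eq_iff sum_fun_apply)

text \<open>Two elements that are both nonzero at a coordinate would already sum to at least 2 there.\<close>
lemma partitions_disjoint_support:
  assumes "\<xi> \<in> partitions k \<alpha>" "\<alpha> i \<le> 1" "\<beta> \<in> \<xi>" "\<gamma> \<in> \<xi>" "\<beta> \<noteq> \<gamma>"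
  shows "\<beta> i = 0 \<or> \<gamma> i = 0"
proof (rule ccontr)
  assume "\<not> ?thesis"
  then have "\<beta> i + \<gamma> i \<ge> 2" by simp
  also have "\<beta> i + \<gamma> i = (\<Sum>\<delta>\<in>{\<beta>, \<gamma>}. \<delta> i)" using assms by simp
  also have "\<dots> \<le> (\<Sum>\<delta>\<in>\<xi>. \<delta> i)"
    using assms partitions_finite by (intro sum_mono2) auto
  also have "\<dots> = \<alpha> i" using assms(1) by (rule partitions_sum)
  finally show False using assms(2) by simp
qed

lemma partitions_Suc_top0:
  assumes "\<alpha> k = 0"
  shows "partitions (Suc k) \<alpha> = partitions k \<alpha>"
proof (intro equalityI subsetI)
  fix \<xi> assume \<xi>: "\<xi> \<in> partitions (Suc k) \<alpha>"
  have "\<beta> \<in> cube k - {0}" if "\<beta> \<in> \<xi>" for \<beta>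
  proof -
    have "\<beta> k = 0"
      using partitions_sum[OF \<xi>, of k] assms that partitions_finite[OF \<xi>] by simp
    moreover have "\<beta> \<in> cube (Suc k) - {0}" using partitions_subset[OF \<xi>] that by blast
    ultimately show ?thesis using cube_upd_0[of \<beta> k] by (simp add: fun_upd_idem)
  qed
  then show "\<xi> \<in> partitions k \<alpha>"
    using partitions_sum[OF \<xi>] by (intro partitionsI) auto
next
  fix \<xi> assume \<xi>: "\<xi> \<in> partitions k \<alpha>"
  then show "\<xi> \<in> partitions (Suc k) \<alpha>"
    using partitions_subset[OF \<xi>] partitions_sum[OF \<xi>] cube_mono by (intro partitionsI) auto
qed

text \<open>Forgetting the last coordinate turns the last unit vector, if present, into 0, which is no
  element of a partition and therefore has to be removed.\<close>
definition truncate :: "nat \<Rightarrow> mindex set \<Rightarrow> mindex set" where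
  "truncate k \<xi> = (\<lambda>\<delta>. \<delta>(k := 0)) ` \<xi> - {0}"

text \<open>For \<open>\<delta> = 0\<close> this adds the last unit vector; otherwise it raises the last coordinate of the
  element \<open>\<delta>\<close>.\<close>
definition extend :: "nat \<Rightarrow> mindex set \<Rightarrow> mindex \<Rightarrow> mindex set" where
  "extend k \<xi> \<delta> = insert (\<delta>(k := 1)) (\<xi> - {\<delta>})"

lemma upd_0_id: "\<beta> \<in> cube k \<Longrightarrow> \<beta>(k := 0) = \<beta>"
  by (simp add: fun_upd_idem cube_top)

lemma truncate_id:
  assumes "\<xi> \<subseteq> cube k - {0}"
  shows "truncate k \<xi> = \<xi>"
proof -
  have "(\<lambda>\<delta>. \<delta>(k := 0)) ` \<xi> = \<xi>"
    using assms upd_0_id by (force simp: image_iff)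
  then show ?thesis using assms by (auto simp: truncate_def)
qed

lemma truncate_extend:
  assumes "\<xi> \<subseteq> cube k - {0}" "\<delta> \<in> insert 0 \<xi>"
  shows "truncate k (extend k \<xi> \<delta>) = \<xi>"
proof -
  have \<delta>: "\<delta>(k := 0) = \<delta>" using assms zero_in_cube upd_0_id by blast
  have "truncate k (\<xi> - {\<delta>}) = \<xi> - {\<delta>}" using assms by (intro truncate_id) auto
  moreover have "truncate k (extend k \<xi> \<delta>) = ({\<delta>} - {0}) \<union> truncate k (\<xi> - {\<delta>})"
    by (auto simp: truncate_def extend_def \<delta>)
  ultimately show ?thesis using assms by auto
qed

text \<open>The sum increases by the last unit vector. This holds for \<open>\<delta> = 0\<close> as well, since then
  nothing is removed from \<open>\<xi>\<close>.\<close>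
lemma extend_in_partitions:
  assumes \<xi>: "\<xi> \<in> partitions k (\<alpha>(k := 0))" and \<delta>: "\<delta> \<in> insert 0 \<xi>" and "\<alpha> k = 1"
  shows "extend k \<xi> \<delta> \<in> partitions (Suc k) \<alpha>"
proof (rule partitionsI)
  have sub: "insert 0 \<xi> \<subseteq> cube k" using \<xi> by (rule partitions_insert0_subset)
  have ne: "\<delta>(k := 1) \<noteq> 0" by (auto simp: fun_eq_iff)
  show "extend k \<xi> \<delta> \<subseteq> cube (Suc k) - {0}"
  proof
    fix \<beta> assume "\<beta> \<in> extend k \<xi> \<delta>"
    then consider "\<beta> = \<delta>(k := 1)" | "\<beta> \<in> \<xi>" by (auto simp: extend_def)
    then show "\<beta> \<in> cube (Suc k) - {0}"
    proof cases
      case 1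
      have "\<delta> \<in> cube k" using sub \<delta> by blast
      then show ?thesis unfolding 1 using cube_upd_1 ne by simp
    next
      case 2
      then show ?thesis using partitions_subset[OF \<xi>] cube_mono by blast
    qed
  qed
  fix i
  have fin: "finite \<xi>" using \<xi> by (rule partitions_finite)
  have notin: "\<delta>(k := 1) \<notin> \<xi>"
    using sub cube_top[of "\<delta>(k := 1)" k] by auto
  have "(\<Sum>\<beta>\<in>extend k \<xi> \<delta>. \<beta> i) = (\<delta>(k := 1)) i + (\<Sum>\<beta>\<in>\<xi> - {\<delta>}. \<beta> i)"
    using fin notin by (simp add: extend_def)
  also have "(\<delta>(k := 1)) i = \<delta> i + (if i = k then 1 else 0)"
    using sub \<delta> cube_top[of \<delta> k] by auto
  also have "\<delta> i + (if i = k then 1 else 0) + (\<Sum>\<beta>\<in>\<xi> - {\<delta>}. \<beta> i)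
      = (\<Sum>\<beta>\<in>\<xi>. \<beta> i) + (if i = k then 1 else 0)"
  proof (cases "\<delta> \<in> \<xi>")
    case True
    then show ?thesis using fin by (simp add: sum.remove)
  next
    case False
    then have "\<delta> = 0" using \<delta> by simp
    then show ?thesis using False by simp
  qed
  also have "\<dots> = \<alpha> i"
    using partitions_sum[OF \<xi>, of i] assms(3) by auto
  finally show "(\<Sum>\<beta>\<in>extend k \<xi> \<delta>. \<beta> i) = \<alpha> i" .
qed

text \<open>Since \<open>\<alpha> k = 1\<close>, exactly one element \<open>\<epsilon>\<close> of \<open>\<xi>\<close> has last coordinate 1. The sum over
  the truncation is right because truncating \<open>\<epsilon>\<close> cannot produce another element of \<open>\<xi>\<close>:
  the supports are disjoint.\<close>
lemma partition_Suc_extend: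
  assumes \<alpha>: "\<alpha> \<in> cube (Suc k)" "\<alpha> k = 1" and \<xi>: "\<xi> \<in> partitions (Suc k) \<alpha>"
  obtains \<delta> where "truncate k \<xi> \<in> partitions k (\<alpha>(k := 0))" "\<delta> \<in> insert 0 (truncate k \<xi>)"
    "\<xi> = extend k (truncate k \<xi>) \<delta>"
proof -
  have fin: "finite \<xi>" using \<xi> by (rule partitions_finite)
  have le1: "\<alpha> i \<le> 1" for i using \<alpha>(1) by (auto simp: cube_iff)
  have sub: "\<xi> \<subseteq> cube (Suc k) - {0}" using \<xi> by (rule partitions_subset)
  have "\<exists>\<epsilon>\<in>\<xi>. \<epsilon> k \<noteq> 0"
    using partitions_sum[OF \<xi>, of k] \<alpha>(2) by (metis sum.neutral zero_neq_one)
  then obtain \<epsilon> where \<epsilon>: "\<epsilon> \<in> \<xi>" "\<epsilon> k \<noteq> 0" by blast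
  have "\<epsilon> k \<le> 1" using \<epsilon> sub by (auto simp: cube_iff)
  then have \<epsilon>1: "\<epsilon> k = 1" using \<epsilon>(2) by simp
  define \<eta> where "\<eta> = \<xi> - {\<epsilon>}"
  define \<delta> where "\<delta> = \<epsilon>(k := 0)"
  have \<epsilon>_eq: "\<epsilon> = \<delta>(k := 1)" using \<epsilon>1 by (auto simp: \<delta>_def fun_eq_iff)
  have \<eta>0: "\<beta> k = 0" if "\<beta> \<in> \<eta>" for \<beta>
    using partitions_disjoint_support[OF \<xi> le1 _ \<epsilon>(1), of \<beta> k] that \<epsilon>(2) by (auto simp: \<eta>_def)
  have \<eta>sub: "\<eta> \<subseteq> cube k - {0}"
  proof
    fix \<beta> assume "\<beta> \<in> \<eta>"
    then show "\<beta> \<in> cube k - {0}"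
      using \<eta>0[of \<beta>] sub cube_upd_0[of \<beta> k] by (auto simp: \<eta>_def fun_upd_idem)
  qed
  have \<delta>notin: "\<delta> \<notin> \<eta>"
  proof
    assume "\<delta> \<in> \<eta>"
    then have "\<delta> \<noteq> 0" using \<eta>sub by blast
    then obtain i where i: "\<delta> i \<noteq> 0" by (auto simp: fun_eq_iff)
    then have "\<epsilon> i \<noteq> 0" by (auto simp: \<delta>_def split: if_splits)
    then show False
      using partitions_disjoint_support[OF \<xi> le1 _ \<epsilon>(1), of \<delta> i] i \<open>\<delta> \<in> \<eta>\<close> by (auto simp: \<eta>_def)
  qed
  have \<xi>_eq: "\<xi> = insert \<epsilon> \<eta>" using \<epsilon> by (auto simp: \<eta>_def)
  have "truncate k \<xi> = ({\<delta>} - {0}) \<union> truncate k \<eta>"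
    unfolding \<xi>_eq truncate_def \<delta>_def by blast
  then have tr: "truncate k \<xi> = ({\<delta>} - {0}) \<union> \<eta>"
    using truncate_id[OF \<eta>sub] by simp
  have \<delta>cube: "\<delta> \<in> cube k" using \<epsilon> sub cube_upd_0 by (auto simp: \<delta>_def)
  show ?thesis
  proof
    show "truncate k \<xi> \<in> partitions k (\<alpha>(k := 0))"
    proof (rule partitionsI)
      show "truncate k \<xi> \<subseteq> cube k - {0}" unfolding tr using \<delta>cube \<eta>sub by auto
      fix i
      have \<eta>fin: "finite \<eta>" using fin by (simp add: \<eta>_def)
      have "(\<Sum>\<beta>\<in>truncate k \<xi>. \<beta> i) = \<delta> i + (\<Sum>\<beta>\<in>\<eta>. \<beta> i)"
        using \<eta>fin \<delta>notin by (cases "\<delta> = 0") (auto simp: tr)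
      moreover have "\<alpha> i = \<epsilon> i + (\<Sum>\<beta>\<in>\<eta>. \<beta> i)"
        using partitions_sum[OF \<xi>, of i] fin \<epsilon>(1) by (simp add: \<eta>_def sum.remove)
      moreover have "i = k \<Longrightarrow> (\<Sum>\<beta>\<in>\<eta>. \<beta> i) = 0" using \<eta>0 by (simp add: sum.neutral)
      ultimately show "(\<Sum>\<beta>\<in>truncate k \<xi>. \<beta> i) = (\<alpha>(k := 0)) i"
        by (simp add: \<delta>_def)
    qed
    show "\<delta> \<in> insert 0 (truncate k \<xi>)" using tr by blast
    show "\<xi> = extend k (truncate k \<xi>) \<delta>"
      using \<xi>_eq tr \<delta>notin \<eta>sub unfolding extend_def \<epsilon>_eq by blast
  qed
qed

lemma extend_inj:
  assumes \<xi>: "\<xi> \<subseteq> cube k - {0}" "\<delta> \<in> insert 0 \<xi>"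
    and \<eta>: "\<eta> \<subseteq> cube k - {0}" "\<epsilon> \<in> insert 0 \<eta>"
    and eq: "extend k \<xi> \<delta> = extend k \<eta> \<epsilon>"
  shows "\<xi> = \<eta> \<and> \<delta> = \<epsilon>"
proof
  show "\<xi> = \<eta>" using truncate_extend \<xi> \<eta> eq by metis
  have "\<delta>(k := 1) \<in> extend k \<eta> \<epsilon>" using eq by (auto simp: extend_def)
  moreover have "\<delta>(k := 1) \<notin> \<eta>" using \<eta>(1) cube_top[of "\<delta>(k := 1)" k] by auto
  ultimately have "\<delta>(k := 1) = \<epsilon>(k := 1)" by (auto simp: extend_def)
  then have "\<delta>(k := 0) = \<epsilon>(k := 0)" by (metis fun_upd_upd)
  then show "\<delta> = \<epsilon>" using \<xi> \<eta> zero_in_cube upd_0_id by (metis Diff_subset insert_iff subsetD)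
qed

lemma bij_betw_extend:
  assumes "\<alpha> \<in> cube (Suc k)" "\<alpha> k = 1"
  shows "bij_betw (\<lambda>(\<xi>, \<delta>). extend k \<xi> \<delta>)
    (SIGMA \<xi>:partitions k (\<alpha>(k := 0)). insert 0 \<xi>) (partitions (Suc k) \<alpha>)"
proof (rule bij_betw_imageI)
  show "inj_on (\<lambda>(\<xi>, \<delta>). extend k \<xi> \<delta>) (SIGMA \<xi>:partitions k (\<alpha>(k := 0)). insert 0 \<xi>)"
  proof (rule inj_onI, clarify)
    fix \<xi> \<delta> \<eta> \<epsilon>
    assume "\<xi> \<in> partitions k (\<alpha>(k := 0))" "\<delta> \<in> insert 0 \<xi>"
      "\<eta> \<in> partitions k (\<alpha>(k := 0))" "\<epsilon> \<in> insert 0 \<eta>" "extend k \<xi> \<delta> = extend k \<eta> \<epsilon>"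
    then show "\<xi> = \<eta> \<and> \<delta> = \<epsilon>" by (intro extend_inj[of \<xi> k]) (auto dest: partitions_subset)
  qed
  show "(\<lambda>(\<xi>, \<delta>). extend k \<xi> \<delta>) ` (SIGMA \<xi>:partitions k (\<alpha>(k := 0)). insert 0 \<xi>)
      = partitions (Suc k) \<alpha>"
  proof (intro equalityI subsetI)
    fix \<xi> assume "\<xi> \<in> partitions (Suc k) \<alpha>"
    then obtain \<delta> where "truncate k \<xi> \<in> partitions k (\<alpha>(k := 0))"
      "\<delta> \<in> insert 0 (truncate k \<xi>)" "\<xi> = extend k (truncate k \<xi>) \<delta>"
      using partition_Suc_extend assms by metis
    then show "\<xi> \<in> (\<lambda>(\<xi>, \<delta>). extend k \<xi> \<delta>) ` (SIGMA \<xi>:partitions k (\<alpha>(k := 0)). insert 0 \<xi>)"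
      by (intro image_eqI[of _ _ "(truncate k \<xi>, \<delta>)"]) auto
  qed (use assms extend_in_partitions in auto)
qed

section \<open>The sets attached to a partition\<close>

definition lift :: "nat \<Rightarrow> mindex set \<Rightarrow> mindex set" where
  "lift k S = (\<lambda>\<gamma>. \<gamma>(k := 1)) ` S"

lemma chain_set_Suc_top0:
  assumes "\<xi> \<in> partitions k \<alpha>" "\<beta> \<in> insert 0 \<xi>"
  shows "chain_set (Suc k) \<xi> \<beta> = chain_set k \<xi> \<beta>"
proof -
  have "truncate k \<xi> = \<xi>" using assms(1) by (intro truncate_id partitions_subset)
  moreover have "\<beta> k = 0" "{\<delta> \<in> \<xi>. \<delta> k = 1} = {}"
    using partitions_insert0_subset[OF assms(1)] assms(2) cube_top by fastforce+
  ultimately show ?thesis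
    by (simp only: chain_set.simps truncate_def) (simp add: Let_def)
qed

text \<open>The recursion for \<open>chain_set\<close>, seen from the smaller partition. The first equation gives the
  set of the raised element. In the second, the elements before \<open>\<delta>\<close> in the order of weights have
  already received their lifted translates, and the base point absorbs the set of \<open>\<delta>\<close>; for
  \<open>\<delta> = 0\<close> this adds nothing, as then it is the set of the base point itself.\<close>
lemma chain_set_extend:
  assumes \<xi>: "\<xi> \<subseteq> cube k - {0}" and \<delta>: "\<delta> \<in> insert 0 \<xi>"
  shows "chain_set (Suc k) (extend k \<xi> \<delta>) (\<delta>(k := 1)) = lift k (chain_set k \<xi> \<delta>)"
    and "\<beta> \<in> cube k \<Longrightarrow> chain_set (Suc k) (extend k \<xi> \<delta>) \<beta> =
      chain_set k \<xi> \<beta> \<union> (if weight k \<beta> < weight k \<delta> then lift k (chain_set k \<xi> \<beta>) else {}) \<union>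
      (if \<beta> = 0 then chain_set k \<xi> \<delta> else {})"
proof -
  have tr: "(\<lambda>\<delta>. \<delta>(k := 0)) ` extend k \<xi> \<delta> - {0} = \<xi>"
    using truncate_extend[OF \<xi> \<delta>] by (simp add: truncate_def)
  have \<delta>0: "\<delta>(k := 0) = \<delta>" using assms zero_in_cube upd_0_id by blast
  have top: "{\<epsilon> \<in> extend k \<xi> \<delta>. \<epsilon> k = 1} = {\<delta>(k := 1)}"
    using \<xi> cube_top by (fastforce simp: extend_def)
  show "chain_set (Suc k) (extend k \<xi> \<delta>) (\<delta>(k := 1)) = lift k (chain_set k \<xi> \<delta>)"
    by (simp only: chain_set.simps Let_def tr) (simp add: lift_def \<delta>0)
  assume "\<beta> \<in> cube k"
  then have "\<beta> k = 0" by (rule cube_top)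
  then show "chain_set (Suc k) (extend k \<xi> \<delta>) \<beta> =
      chain_set k \<xi> \<beta> \<union> (if weight k \<beta> < weight k \<delta> then lift k (chain_set k \<xi> \<beta>) else {}) \<union>
      (if \<beta> = 0 then chain_set k \<xi> \<delta> else {})"
    by (simp only: chain_set.simps Let_def tr top) (auto simp add: lift_def \<delta>0)
qed

definition proper_chains :: "nat \<Rightarrow> mindex \<Rightarrow> mindex set \<Rightarrow> bool" where
  "proper_chains k \<alpha> \<xi> \<longleftrightarrow>
    disjoint_family_on (chain_set k \<xi>) (insert 0 \<xi>) \<and>
    (\<forall>\<beta>\<in>insert 0 \<xi>. \<beta> \<in> chain_set k \<xi> \<beta> \<and> chain_set k \<xi> \<beta> \<subseteq> mbox k \<alpha>) \<and>
    (\<forall>\<beta>\<in>insert 0 \<xi>. \<forall>\<gamma>\<in>chain_set k \<xi> \<beta> - {\<beta>}. msize k \<gamma> > msize k \<beta>)"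

lemma mbox_top: "\<gamma> \<in> mbox k \<alpha> \<Longrightarrow> \<gamma> k = 0"
  by (auto simp: mbox_def mindices_def)

lemma mbox_iff: "\<gamma> \<in> mbox k \<alpha> \<longleftrightarrow> (\<forall>i\<ge>k. \<gamma> i = 0) \<and> (\<forall>i. \<gamma> i \<le> \<alpha> i)"
  by (simp add: mbox_def mindices_def le_fun_def)

lemma mbox_Suc_mono:
  assumes "\<gamma> \<in> mbox k (\<alpha>(k := 0))"
  shows "\<gamma> \<in> mbox (Suc k) \<alpha>"
proof -
  have "\<gamma> i \<le> \<alpha> i" for i
  proof -
    have "\<gamma> i \<le> (\<alpha>(k := 0)) i" using assms unfolding mbox_iff by blast
    then show ?thesis by (cases "i = k") simp_all
  qed
  then show ?thesis using assms by (simp add: mbox_iff)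
qed

lemma mbox_Suc_lift:
  assumes "\<gamma> \<in> mbox k (\<alpha>(k := 0))" "\<alpha> k = 1"
  shows "\<gamma>(k := 1) \<in> mbox (Suc k) \<alpha>"
proof -
  have "\<gamma> i \<le> \<alpha> i" for i
    using mbox_Suc_mono[OF assms(1)] by (simp add: mbox_iff)
  then show ?thesis using assms by (simp add: mbox_iff)
qed

text \<open>The sets of \<open>extend k \<xi> \<delta>\<close> are composed of the old sets \<open>A \<beta>\<close> and their lifts. An old set
  other than \<open>A \<delta>\<close> enters only the new set with the same index, and so does its lift; \<open>A \<delta>\<close> goes
  to the base point and its lift to the raised element. As the sets \<open>A \<beta>\<close> are disjoint and the
  last coordinate separates them from the lifts, the new sets are disjoint. Lifting increases the
  size by one, so the sizes grow as required, and any nonzero member of the set of the base point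
  has positive size.\<close>
lemma proper_chains_extend:
  assumes pc: "proper_chains k (\<alpha>(k := 0)) \<xi>" and \<alpha>: "\<alpha> k = 1"
    and \<xi>: "\<xi> \<in> partitions k (\<alpha>(k := 0))" and \<delta>: "\<delta> \<in> insert 0 \<xi>"
  shows "proper_chains (Suc k) \<alpha> (extend k \<xi> \<delta>)"
proof -
  define A where "A = chain_set k \<xi>"
  define C where "C = chain_set (Suc k) (extend k \<xi> \<delta>)"
  define \<epsilon> where "\<epsilon> = \<delta>(k := 1)"
  define \<eta> where "\<eta> = insert 0 (\<xi> - {\<delta>})"
  note chains = chain_set_extend[OF partitions_subset[OF \<xi>] \<delta>, folded A_def C_def \<epsilon>_def]
  have sub: "insert 0 \<xi> \<subseteq> cube k" using \<xi> by (rule partitions_insert0_subset)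
  have ins: "insert 0 (extend k \<xi> \<delta>) = insert \<epsilon> \<eta>"
    by (auto simp: extend_def \<epsilon>_def \<eta>_def)
  have \<eta>: "\<beta> \<in> insert 0 \<xi>" "\<beta> \<in> cube k" "\<beta> = \<delta> \<Longrightarrow> \<beta> = 0" if "\<beta> \<in> \<eta>" for \<beta>
    using that sub by (auto simp: \<eta>_def)
  have Adisj: "A \<beta> \<inter> A \<gamma> = {}" if "\<beta> \<in> insert 0 \<xi>" "\<gamma> \<in> insert 0 \<xi>" "\<beta> \<noteq> \<gamma>" for \<beta> \<gamma>
    using pc that unfolding proper_chains_def disjoint_family_on_def A_def by blast
  have Aself: "\<beta> \<in> A \<beta>" if "\<beta> \<in> insert 0 \<xi>" for \<beta>
    using pc that by (auto simp: proper_chains_def A_def)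
  have Abox: "\<gamma> \<in> mbox k (\<alpha>(k := 0))" if "\<beta> \<in> insert 0 \<xi>" "\<gamma> \<in> A \<beta>" for \<beta> \<gamma>
    using pc that unfolding proper_chains_def A_def by blast
  have Asize: "msize k \<gamma> > msize k \<beta>" if "\<beta> \<in> insert 0 \<xi>" "\<gamma> \<in> A \<beta>" "\<gamma> \<noteq> \<beta>" for \<beta> \<gamma>
    using pc that unfolding proper_chains_def A_def by blast
  have Asize': "msize k \<gamma> \<ge> msize k \<beta>" if "\<beta> \<in> insert 0 \<xi>" "\<gamma> \<in> A \<beta>" for \<beta> \<gamma>
    using Asize[OF that] by (cases "\<gamma> = \<beta>") auto
  have Atop: "\<gamma> k = 0" if "\<beta> \<in> insert 0 \<xi>" "\<gamma> \<in> A \<beta>" for \<beta> \<gamma>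
    using Abox[OF that] by (rule mbox_top)
  (* Where a member of a new set comes from: C\<epsilon> for the raised element, C\<eta> for the others.
     The exclusion of \<beta> = \<delta> in C\<eta> holds since A \<beta> is lifted only if
     the weight of \<beta> is strictly below that of \<delta>. *)
  have C\<epsilon>: "\<gamma> k = 1 \<and> \<gamma>(k := 0) \<in> A \<delta>" if "\<gamma> \<in> C \<epsilon>" for \<gamma>
    using that Atop[OF \<delta>] by (auto simp: chains(1) lift_def fun_upd_idem)
  have C\<eta>: "\<gamma> k = 0 \<and> \<gamma> \<in> A \<beta> \<or> \<gamma> k = 1 \<and> \<beta> \<noteq> \<delta> \<and> \<gamma>(k := 0) \<in> A \<beta>
      \<or> \<beta> = 0 \<and> \<gamma> k = 0 \<and> \<gamma> \<in> A \<delta>"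
    if "\<beta> \<in> \<eta>" "\<gamma> \<in> C \<beta>" for \<beta> \<gamma>
  proof -
    have "\<beta> \<in> cube k" using \<eta>(2) that(1) .
    with that(2) consider "\<gamma> \<in> A \<beta>" | "\<gamma> \<in> lift k (A \<beta>)" "weight k \<beta> < weight k \<delta>" | "\<beta> = 0" "\<gamma> \<in> A \<delta>"
      by (auto simp: chains(2) split: if_splits)
    then show ?thesis
    proof cases
      case 1
      then show ?thesis using Atop \<eta>(1)[OF that(1)] by blast
    next
      case 2
      then obtain \<mu> where \<mu>: "\<gamma> = \<mu>(k := 1)" "\<mu> \<in> A \<beta>" by (auto simp: lift_def)
      then have "\<gamma>(k := 0) = \<mu>" using Atop[OF \<eta>(1)[OF that(1)] \<mu>(2)] by (simp add: fun_upd_idem)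
      then show ?thesis using 2 \<mu> by auto
    next
      case 3
      then show ?thesis using Atop[OF \<delta>] by blast
    qed
  qed
  have disj1: "C \<epsilon> \<inter> C \<beta> = {}" if "\<beta> \<in> \<eta>" for \<beta>
    using C\<epsilon> C\<eta>[OF that] Adisj[OF \<eta>(1)[OF that] \<delta>] by fastforce
  have disj2: "C \<beta> \<inter> C \<gamma> = {}" if "\<beta> \<in> \<eta>" "\<gamma> \<in> \<eta>" "\<beta> \<noteq> \<gamma>" for \<beta> \<gamma>
  proof (rule ccontr)
    assume "C \<beta> \<inter> C \<gamma> \<noteq> {}"
    then obtain \<mu> where \<mu>: "\<mu> \<in> C \<beta>" "\<mu> \<in> C \<gamma>" by blast
    note * = C\<eta>[OF that(1) \<mu>(1)] C\<eta>[OF that(2) \<mu>(2)]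
    note ** = Adisj[OF \<eta>(1)[OF that(1)] \<eta>(1)[OF that(2)] that(3)]
      Adisj[OF \<eta>(1)[OF that(1)] \<delta>] Adisj[OF \<eta>(1)[OF that(2)] \<delta>]
    show False using * ** that(3) \<eta>(3)[OF that(1)] \<eta>(3)[OF that(2)] by auto
  qed
  have "disjoint_family_on C (insert \<epsilon> \<eta>)"
    unfolding disjoint_family_on_def using disj1 disj2 by blast
  moreover have "\<beta> \<in> C \<beta> \<and> C \<beta> \<subseteq> mbox (Suc k) \<alpha> \<and> (\<forall>\<gamma>\<in>C \<beta> - {\<beta>}. msize (Suc k) \<gamma> > msize (Suc k) \<beta>)"
    if "\<beta> \<in> insert \<epsilon> \<eta>" for \<beta>
  proof (cases "\<beta> = \<epsilon>")
    case True
    have "\<gamma> \<in> mbox (Suc k) \<alpha> \<and> (\<gamma> \<noteq> \<epsilon> \<longrightarrow> msize (Suc k) \<gamma> > msize (Suc k) \<epsilon>)"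
      if "\<gamma> \<in> C \<epsilon>" for \<gamma>
    proof -
      from that obtain \<mu> where \<mu>: "\<gamma> = \<mu>(k := 1)" "\<mu> \<in> A \<delta>"
        by (auto simp: chains(1) lift_def)
      then have "\<gamma> \<in> mbox (Suc k) \<alpha>" using Abox[OF \<delta>] mbox_Suc_lift \<alpha> by blast
      moreover have "msize k \<mu> > msize k \<delta>" if "\<gamma> \<noteq> \<epsilon>"
        using that \<mu> Asize[OF \<delta>] by (auto simp: \<epsilon>_def)
      ultimately show ?thesis by (simp add: \<mu>(1) \<epsilon>_def msize_Suc)
    qed
    moreover have "\<epsilon> \<in> C \<epsilon>"
      using Aself[OF \<delta>] unfolding chains(1) by (auto simp: lift_def \<epsilon>_def)
    ultimately show ?thesis unfolding True by blast
  next
    case False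
    then have \<beta>: "\<beta> \<in> \<eta>" using that by blast
    have box: "\<gamma> \<in> mbox (Suc k) \<alpha>" if "\<gamma> \<in> C \<beta>" for \<gamma>
    proof -
      from C\<eta>[OF \<beta> that]
      consider "\<gamma> \<in> A \<beta>" | "\<gamma> \<in> A \<delta>" | "\<gamma> k = 1" "\<gamma>(k := 0) \<in> A \<beta>" by blast
      then show ?thesis
      proof cases
        case 3
        then have "(\<gamma>(k := 0))(k := 1) \<in> mbox (Suc k) \<alpha>"
          using Abox \<eta>[OF \<beta>] \<alpha> mbox_Suc_lift by blast
        then show ?thesis using 3 by (simp add: fun_upd_idem)
      qed (use Abox \<eta>[OF \<beta>] \<delta> mbox_Suc_mono in blast)+
    qed
    moreover have "msize (Suc k) \<gamma> > msize (Suc k) \<beta>" if "\<gamma> \<in> C \<beta>" "\<gamma> \<noteq> \<beta>" for \<gamma>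
    proof (cases "\<beta> = 0")
      case True
      have "\<gamma> \<in> mindices (Suc k)" using box[OF that(1)] by (simp add: mbox_def)
      then have "msize (Suc k) \<gamma> > 0" using that True by (intro msize_pos) auto
      then show ?thesis using True by (simp add: msize_def)
    next
      case False
      have \<beta>0: "\<beta> k = 0" using \<eta>(2)[OF \<beta>] by (rule cube_top)
      from C\<eta>[OF \<beta> that(1)] False
      consider "\<gamma> k = 0" "\<gamma> \<in> A \<beta>" | "\<gamma> k = 1" "\<gamma>(k := 0) \<in> A \<beta>" by metis
      then show ?thesis
      proof cases
        case 1
        then show ?thesis using Asize[OF \<eta>(1)[OF \<beta>]] that \<beta>0 by (simp add: msize_Suc)
      next
        case 2
        then have "msize k \<beta> \<le> msize k (\<gamma>(k := 0))" using Asize' \<eta>(1)[OF \<beta>] by blast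
        then show ?thesis using 2 \<beta>0 by (simp add: msize_Suc)
      qed
    qed
    moreover have "\<beta> \<in> C \<beta>" using Aself[OF \<eta>(1)[OF \<beta>]] \<eta>[OF \<beta>] by (simp add: chains(2))
    ultimately show ?thesis by blast
  qed
  ultimately show ?thesis
    unfolding proper_chains_def ins C_def[symmetric] by blast
qed

lemma proper_chains_partition:
  "\<alpha> \<in> cube k \<Longrightarrow> \<xi> \<in> partitions k \<alpha> \<Longrightarrow> proper_chains k \<alpha> \<xi>"
proof (induction k arbitrary: \<alpha> \<xi>)
  case 0
  have "cube 0 \<subseteq> {0}" by (auto simp: cube_iff fun_eq_iff)
  then have "\<xi> = {}" using partitions_subset[OF 0(2)] by blast
  then show ?case
    by (auto simp: proper_chains_def disjoint_family_on_def mbox_def mindices_def le_fun_def)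
next
  case (Suc k)
  show ?case
  proof (cases "\<alpha> k = 0")
    case True
    then have \<alpha>: "\<alpha> \<in> cube k" "\<alpha>(k := 0) = \<alpha>"
      using cube_upd_0[OF Suc.prems(1)] by (simp_all add: fun_upd_idem)
    have \<xi>: "\<xi> \<in> partitions k \<alpha>" using Suc.prems(2) partitions_Suc_top0[of \<alpha> k, OF True] by simp
    have pc: "proper_chains k \<alpha> \<xi>" by (rule Suc.IH[OF \<alpha>(1) \<xi>])
    have eq: "chain_set (Suc k) \<xi> \<beta> = chain_set k \<xi> \<beta>" if "\<beta> \<in> insert 0 \<xi>" for \<beta>
      using chain_set_Suc_top0 \<xi> that by blast
    have top: "\<gamma> k = 0" if "\<beta> \<in> insert 0 \<xi>" "\<gamma> \<in> chain_set k \<xi> \<beta>" for \<beta> \<gamma>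
      using pc that mbox_top unfolding proper_chains_def by blast
    have size: "msize (Suc k) \<gamma> = msize k \<gamma>" if "\<beta> \<in> insert 0 \<xi>" "\<gamma> \<in> chain_set k \<xi> \<beta>" for \<beta> \<gamma>
      using top[OF that] by (simp add: msize_Suc)
    have self: "\<beta> \<in> chain_set k \<xi> \<beta>" if "\<beta> \<in> insert 0 \<xi>" for \<beta>
      using pc that unfolding proper_chains_def by blast
    have box: "mbox k \<alpha> \<subseteq> mbox (Suc k) \<alpha>"
      using mbox_Suc_mono[of _ k \<alpha>] \<alpha>(2) by auto
    have "disjoint_family_on (chain_set (Suc k) \<xi>) (insert 0 \<xi>)"
      using pc eq unfolding proper_chains_def disjoint_family_on_def by metis
    moreover have "\<beta> \<in> chain_set (Suc k) \<xi> \<beta> \<and> chain_set (Suc k) \<xi> \<beta> \<subseteq> mbox (Suc k) \<alpha> \<and>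
        (\<forall>\<gamma>\<in>chain_set (Suc k) \<xi> \<beta> - {\<beta>}. msize (Suc k) \<gamma> > msize (Suc k) \<beta>)"
      if "\<beta> \<in> insert 0 \<xi>" for \<beta>
      using pc that box size[OF that] self[OF that] unfolding proper_chains_def eq[OF that]
      by (metis DiffD1 subset_trans)
    ultimately show ?thesis unfolding proper_chains_def by blast
  next
    case False
    have "\<alpha> k \<le> 1" using Suc.prems(1) by (auto simp: cube_iff)
    then have 1: "\<alpha> k = 1" using False by simp
    obtain \<delta> where \<delta>: "truncate k \<xi> \<in> partitions k (\<alpha>(k := 0))"
      "\<delta> \<in> insert 0 (truncate k \<xi>)" "\<xi> = extend k (truncate k \<xi>) \<delta>"
      using partition_Suc_extend[OF Suc.prems(1) 1 Suc.prems(2)] by metis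
    have "proper_chains k (\<alpha>(k := 0)) (truncate k \<xi>)"
      using Suc.IH cube_upd_0[OF Suc.prems(1)] \<delta>(1) by blast
    then have "proper_chains (Suc k) \<alpha> (extend k (truncate k \<xi>) \<delta>)"
      using 1 \<delta>(1,2) by (rule proper_chains_extend)
    then show ?thesis using \<delta>(3) by simp
  qed
qed

lemma finite_mbox: "\<alpha> \<in> cube k \<Longrightarrow> finite (mbox k \<alpha>)"
proof -
  assume "\<alpha> \<in> cube k"
  then have "mbox k \<alpha> \<subseteq> cube k"
    by (auto simp: mbox_def cube_iff mindices_def le_fun_def) (meson le_trans)
  then show ?thesis using finite_cube finite_subset by blast
qed

section \<open>The chain rule\<close>

text \<open>Change the values of the family from \<open>a\<close> to \<open>b\<close> in the order of rank. Ranks that are not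
  attained on \<open>S\<close> contribute nothing, and by injectivity the others change one value each.\<close>
lemma telescope_by_rank:
  fixes F :: "('i \<Rightarrow> 'a) \<Rightarrow> 'b::ab_group_add" and rank :: "'i \<Rightarrow> nat"
  assumes fin: "finite S" and inj: "inj_on rank S"
    and local: "\<And>v w. (\<And>\<beta>. \<beta> \<in> S \<Longrightarrow> v \<beta> = w \<beta>) \<Longrightarrow> F v = F w"
  shows "F b - F a = (\<Sum>\<delta>\<in>S.
    F (\<lambda>\<beta>. if rank \<beta> \<le> rank \<delta> then b \<beta> else a \<beta>) -
    F (\<lambda>\<beta>. if rank \<beta> < rank \<delta> then b \<beta> else a \<beta>))"
proof -
  define G where "G n = F (\<lambda>\<beta>. if rank \<beta> < n then b \<beta> else a \<beta>)" for n
  define N where "N = Suc (Max (insert 0 (rank ` S)))"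
  have N: "rank \<beta> < N" if "\<beta> \<in> S" for \<beta>
    using that fin by (auto simp: N_def less_Suc_eq_le)
  have "F b - F a = G N - G 0"
    using N by (intro arg_cong2[of _ _ _ _ "(-)"] local) (auto simp: G_def intro!: local)
  also have "\<dots> = (\<Sum>n<N. G (Suc n) - G n)"
    by (simp add: sum_lessThan_telescope)
  also have "\<dots> = (\<Sum>n\<in>rank ` S. G (Suc n) - G n)"
  proof (rule sum.mono_neutral_right)
    show "\<forall>n\<in>{..<N} - rank ` S. G (Suc n) - G n = 0"
    proof
      fix n assume n: "n \<in> {..<N} - rank ` S"
      have "G (Suc n) = G n"
        unfolding G_def using n by (intro local) (auto simp: less_Suc_eq)
      then show "G (Suc n) - G n = 0" by simp
    qed
  qed (use N in auto)
  also have "\<dots> = (\<Sum>\<delta>\<in>S. G (Suc (rank \<delta>)) - G (rank \<delta>))"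
    using inj by (simp add: sum.reindex)
  finally show ?thesis by (simp add: G_def less_Suc_eq_le)
qed

text \<open>One summand of the telescope: \<open>b\<close> differs from \<open>a\<close> only at \<open>\<delta>\<close>. If \<open>\<delta> = 0\<close>, the base
  point changes and its change is one more direction. Otherwise
  \<open>fdiff (b \<delta>) h y - fdiff (a \<delta>) h y = fdiff (b \<delta> - a \<delta>) h (y + a \<delta>)\<close>, where \<open>h\<close> carries the
  differences in the remaining directions. The new direction gets the fresh label \<open>\<epsilon>\<close>.\<close>
lemma single_change:
  fixes a b :: "'i::zero \<Rightarrow> 'a::ab_group_add" and f :: "'a \<Rightarrow> 'b::ab_group_add"
  assumes fin: "finite S" "0 \<notin> S" and \<delta>: "\<delta> \<in> insert 0 S" and \<epsilon>: "\<epsilon> \<notin> S"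
    and v\<epsilon>: "v \<epsilon> = b \<delta> - a \<delta>"
    and same: "\<And>\<beta>. \<beta> \<in> insert 0 S - {\<delta>} \<Longrightarrow> b \<beta> = a \<beta>"
    and v: "\<And>\<beta>. \<beta> \<in> S - {\<delta>} \<Longrightarrow> v \<beta> = a \<beta>"
    and v0: "v 0 = (if \<delta> = 0 then a 0 else a 0 + a \<delta>)"
  shows "set_fdiffs b S f (b 0) - set_fdiffs a S f (a 0)
    = set_fdiffs v (insert \<epsilon> (S - {\<delta>})) f (v 0)"
proof -
  define h where "h = set_fdiffs a (S - {\<delta>}) f"
  have hb: "set_fdiffs b (S - {\<delta>}) f = h"
    unfolding h_def using fin same by (intro set_fdiffs_cong) auto
  have "set_fdiffs v (S - {\<delta>}) f = h"
    unfolding h_def using fin v by (intro set_fdiffs_cong) auto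
  then have R: "set_fdiffs v (insert \<epsilon> (S - {\<delta>})) f = fdiff (b \<delta> - a \<delta>) h"
    using fin \<epsilon> v\<epsilon> by (simp add: set_fdiffs_insert)
  show ?thesis
  proof (cases "\<delta> = 0")
    case True
    then have "S - {\<delta>} = S" using fin by simp
    then have "set_fdiffs b S f = h" "set_fdiffs a S f = h" using hb h_def by simp_all
    then show ?thesis unfolding R using True v0 by (simp add: fdiff_def)
  next
    case False
    then have S: "S = insert \<delta> (S - {\<delta>})" using \<delta> by blast
    have "set_fdiffs w S f = fdiff (w \<delta>) (set_fdiffs w (S - {\<delta>}) f)" for w
      using fin by (subst S, subst set_fdiffs_insert) auto
    then have "set_fdiffs b S f = fdiff (b \<delta>) h" "set_fdiffs a S f = fdiff (a \<delta>) h"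
      using hb h_def by simp_all
    moreover have "b 0 = a 0" using same False by simp
    ultimately show ?thesis unfolding R using False v0 by (simp add: fdiff_def algebra_simps)
  qed
qed

definition direction ::
  "nat \<Rightarrow> (nat \<Rightarrow> 'z::ab_group_add) \<Rightarrow> ('z \<Rightarrow> 'x::ab_group_add) \<Rightarrow> 'z \<Rightarrow> mindex set \<Rightarrow> mindex \<Rightarrow> 'x"
where
  "direction k u g x \<xi> \<beta> = (\<Sum>\<gamma>\<in>chain_set k \<xi> \<beta>. mdiff k u \<gamma> g x)"

text \<open>Lifting the indices applies the difference operator of the last coordinate to the whole
  sum; this is why lifts appear in the recursion for \<open>chain_set\<close>.\<close>
lemma sum_mdiff_Suc:
  assumes "\<And>\<gamma>. \<gamma> \<in> S \<Longrightarrow> \<gamma> k = 0"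
  shows "(\<Sum>\<gamma>\<in>S. mdiff (Suc k) u \<gamma> g x) = (\<Sum>\<gamma>\<in>S. mdiff k u \<gamma> g x)"
    and "(\<Sum>\<gamma>\<in>lift k S. mdiff (Suc k) u \<gamma> g x)
      = (\<Sum>\<gamma>\<in>S. mdiff k u \<gamma> g (x + u k)) - (\<Sum>\<gamma>\<in>S. mdiff k u \<gamma> g x)"
proof -
  show "(\<Sum>\<gamma>\<in>S. mdiff (Suc k) u \<gamma> g x) = (\<Sum>\<gamma>\<in>S. mdiff k u \<gamma> g x)"
    using assms by (intro sum.cong) (simp_all add: mdiff_Suc_0)
  have inj: "inj_on (\<lambda>\<gamma>. \<gamma>(k := 1)) S"
    by (rule inj_on_inverseI[of _ "\<lambda>\<gamma>. \<gamma>(k := 0)"]) (simp add: assms fun_upd_idem)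
  have "(\<Sum>\<gamma>\<in>lift k S. mdiff (Suc k) u \<gamma> g x) = (\<Sum>\<gamma>\<in>S. mdiff (Suc k) u (\<gamma>(k := 1)) g x)"
    unfolding lift_def by (subst sum.reindex[OF inj]) simp
  also have "\<dots> = (\<Sum>\<gamma>\<in>S. mdiff k u \<gamma> g (x + u k) - mdiff k u \<gamma> g x)"
    by (intro sum.cong) (simp_all add: mdiff_Suc_1 mdiff_upd fdiff_def)
  finally show "(\<Sum>\<gamma>\<in>lift k S. mdiff (Suc k) u \<gamma> g x)
      = (\<Sum>\<gamma>\<in>S. mdiff k u \<gamma> g (x + u k)) - (\<Sum>\<gamma>\<in>S. mdiff k u \<gamma> g x)"
    by (simp add: sum_subtractf)
qed

text \<open>The vectors of the extended partition are those required by \<open>single_change\<close> in the summand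
  of the telescope that belongs to \<open>\<delta>\<close>: the values before \<open>\<delta>\<close> are already those at the
  translated point \<open>x + u k\<close>, the change at \<open>\<delta>\<close> is the new direction, and the old direction
  \<open>a \<delta>\<close> is added to the base point.\<close>
lemma direction_extend:
  fixes u :: "nat \<Rightarrow> 'z::ab_group_add" and g :: "'z \<Rightarrow> 'x::ab_group_add" and x :: 'z
  assumes \<alpha>: "\<alpha> \<in> cube k" and \<xi>: "\<xi> \<in> partitions k \<alpha>" and \<delta>: "\<delta> \<in> insert 0 \<xi>"
  defines "a \<equiv> direction k u g x \<xi>" and "b \<equiv> direction k u g (x + u k) \<xi>"
    and "v \<equiv> direction (Suc k) u g x (extend k \<xi> \<delta>)"
  shows "v (\<delta>(k := 1)) = b \<delta> - a \<delta>"
    and "\<beta> \<in> insert 0 \<xi> \<Longrightarrow> v \<beta> = (if weight k \<beta> < weight k \<delta> then b \<beta> else a \<beta>)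
      + (if \<beta> = 0 \<and> \<delta> \<noteq> 0 then a \<delta> else 0)"
proof -
  define A where "A = chain_set k \<xi>"
  note chains = chain_set_extend[OF partitions_subset[OF \<xi>] \<delta>, folded A_def]
  have pc: "proper_chains k \<alpha> \<xi>" using \<alpha> \<xi> by (rule proper_chains_partition)
  have Abox: "A \<beta> \<subseteq> mbox k \<alpha>" if "\<beta> \<in> insert 0 \<xi>" for \<beta>
    using pc that by (auto simp: proper_chains_def A_def)
  have Atop: "\<gamma> k = 0" if "\<beta> \<in> insert 0 \<xi>" "\<gamma> \<in> A \<beta>" for \<beta> \<gamma>
    using Abox[OF that(1)] that(2) mbox_top by blast
  have Afin: "finite (A \<beta>)" if "\<beta> \<in> insert 0 \<xi>" for \<beta>
    using Abox[OF that] finite_mbox[OF \<alpha>] finite_subset by blast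
  have low: "(\<Sum>\<gamma>\<in>A \<beta>. mdiff (Suc k) u \<gamma> g x) = a \<beta>" if "\<beta> \<in> insert 0 \<xi>" for \<beta>
    unfolding a_def direction_def A_def[symmetric] using Atop that by (intro sum_mdiff_Suc) auto
  have up: "(\<Sum>\<gamma>\<in>lift k (A \<beta>). mdiff (Suc k) u \<gamma> g x) = b \<beta> - a \<beta>" if "\<beta> \<in> insert 0 \<xi>" for \<beta>
    unfolding a_def b_def direction_def A_def[symmetric]
    using Atop that by (intro sum_mdiff_Suc) auto
  show "v (\<delta>(k := 1)) = b \<delta> - a \<delta>"
    unfolding v_def direction_def chains(1) by (rule up[OF \<delta>])
  assume \<beta>: "\<beta> \<in> insert 0 \<xi>"
  then have "\<beta> \<in> cube k" using partitions_insert0_subset[OF \<xi>] by blast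
  note C = chains(2)[OF this]
  define B where "B = A \<beta> \<union> (if weight k \<beta> < weight k \<delta> then lift k (A \<beta>) else {})"
  have liftdisj: "A \<gamma> \<inter> lift k (A \<beta>) = {}" if "\<gamma> \<in> insert 0 \<xi>" for \<gamma>
    using Atop[OF that] by (fastforce simp: lift_def)
  have finlift: "finite (lift k (A \<beta>))" using Afin[OF \<beta>] by (simp add: lift_def)
  have B: "(\<Sum>\<gamma>\<in>B. mdiff (Suc k) u \<gamma> g x) = (if weight k \<beta> < weight k \<delta> then b \<beta> else a \<beta>)"
    using Afin[OF \<beta>] finlift liftdisj[OF \<beta>] low[OF \<beta>] up[OF \<beta>]
    by (simp add: B_def sum.union_disjoint)
  have Bfin: "finite B" using Afin[OF \<beta>] finlift by (simp add: B_def)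
  show "v \<beta> = (if weight k \<beta> < weight k \<delta> then b \<beta> else a \<beta>)
      + (if \<beta> = 0 \<and> \<delta> \<noteq> 0 then a \<delta> else 0)"
  proof (cases "\<beta> = 0 \<and> \<delta> \<noteq> 0")
    case True
    then have "A \<beta> \<inter> A \<delta> = {}"
      using pc \<beta> \<delta> unfolding proper_chains_def disjoint_family_on_def A_def by blast
    then have "B \<inter> A \<delta> = {}" using liftdisj[OF \<delta>] by (auto simp: B_def)
    moreover have "chain_set (Suc k) (extend k \<xi> \<delta>) \<beta> = B \<union> A \<delta>"
      using C True by (simp add: B_def)
    ultimately show ?thesis
      unfolding v_def direction_def
      using True Bfin Afin[OF \<delta>] B low[OF \<delta>] by (simp add: sum.union_disjoint)
  next
    case False
    then have "chain_set (Suc k) (extend k \<xi> \<delta>) \<beta> = B"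
      using C by (auto simp: B_def)
    then show ?thesis
      unfolding v_def direction_def using False B by auto
  qed
qed

text \<open>Telescoping along the weight, which has its least value at 0, so that the base point changes
  first: whenever a direction changes, the base point is already that at \<open>x + u k\<close>.\<close>
lemma finite_difference_step:
  fixes u :: "nat \<Rightarrow> 'z::ab_group_add" and g :: "'z \<Rightarrow> 'x::ab_group_add" and x :: 'z
  assumes \<alpha>: "\<alpha> \<in> cube k" and \<xi>: "\<xi> \<in> partitions k \<alpha>"
  defines "a \<equiv> direction k u g x \<xi>" and "b \<equiv> direction k u g (x + u k) \<xi>"
    and "v \<equiv> \<lambda>\<delta>. direction (Suc k) u g x (extend k \<xi> \<delta>)"
  shows "set_fdiffs b \<xi> f (b 0) - set_fdiffs a \<xi> f (a 0)
    = (\<Sum>\<delta>\<in>insert 0 \<xi>. set_fdiffs (v \<delta>) (extend k \<xi> \<delta>) f (v \<delta> 0))"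
proof -
  have sub: "insert 0 \<xi> \<subseteq> cube k" using \<xi> by (rule partitions_insert0_subset)
  have fin: "finite \<xi>" and 0: "0 \<notin> \<xi>"
    using partitions_finite[OF \<xi>] partitions_subset[OF \<xi>] by blast+
  have inj: "inj_on (weight k) (insert 0 \<xi>)"
    using weight_inj sub by (intro inj_onI) blast
  define F where "F w = set_fdiffs w \<xi> f (w 0)" for w
  have "F b - F a = (\<Sum>\<delta>\<in>insert 0 \<xi>.
      F (\<lambda>\<beta>. if weight k \<beta> \<le> weight k \<delta> then b \<beta> else a \<beta>) -
      F (\<lambda>\<beta>. if weight k \<beta> < weight k \<delta> then b \<beta> else a \<beta>))"
  proof (rule telescope_by_rank)
    fix w w' :: "mindex \<Rightarrow> 'x"
    assume eq: "\<And>\<beta>. \<beta> \<in> insert 0 \<xi> \<Longrightarrow> w \<beta> = w' \<beta>"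
    then have "set_fdiffs w \<xi> f = set_fdiffs w' \<xi> f" using fin by (intro set_fdiffs_cong) auto
    then show "F w = F w'" using eq by (simp add: F_def)
  qed (use fin inj in auto)
  also have "\<dots> = (\<Sum>\<delta>\<in>insert 0 \<xi>. set_fdiffs (v \<delta>) (extend k \<xi> \<delta>) f (v \<delta> 0))"
  proof (rule sum.cong[OF refl])
    fix \<delta> assume \<delta>: "\<delta> \<in> insert 0 \<xi>"
    note dir = direction_extend[OF \<alpha> \<xi> \<delta>, where u = u and g = g and x = x,
        folded a_def b_def]
    have wt: "weight k \<beta> \<le> weight k \<delta> \<longleftrightarrow> weight k \<beta> < weight k \<delta>"
      if "\<beta> \<in> insert 0 \<xi> - {\<delta>}" for \<beta>
      using inj_onD[OF inj _ _ \<delta>, of \<beta>] that by (auto simp: le_less)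
    have pos: "0 < weight k \<delta>" if "\<delta> \<noteq> 0"
      using wt[of 0] that by simp
    have "\<delta>(k := 1) \<notin> \<xi>" using sub cube_top[of "\<delta>(k := 1)" k] by auto
    with fin 0 \<delta> show
      "F (\<lambda>\<beta>. if weight k \<beta> \<le> weight k \<delta> then b \<beta> else a \<beta>) -
       F (\<lambda>\<beta>. if weight k \<beta> < weight k \<delta> then b \<beta> else a \<beta>)
       = set_fdiffs (v \<delta>) (extend k \<xi> \<delta>) f (v \<delta> 0)"
      unfolding F_def extend_def
    proof (rule single_change)
      show "v \<delta> (\<delta>(k := 1)) = (if weight k \<delta> \<le> weight k \<delta> then b \<delta> else a \<delta>) -
          (if weight k \<delta> < weight k \<delta> then b \<delta> else a \<delta>)"
        using dir(1) by (simp add: v_def)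
      show "v \<delta> \<beta> = (if weight k \<beta> < weight k \<delta> then b \<beta> else a \<beta>)" if "\<beta> \<in> \<xi> - {\<delta>}" for \<beta>
        using dir(2)[of \<beta>] that 0 by (auto simp: v_def)
      show "v \<delta> 0 = (if \<delta> = 0 then if weight k 0 < weight k \<delta> then b 0 else a 0
          else (if weight k 0 < weight k \<delta> then b 0 else a 0) +
            (if weight k \<delta> < weight k \<delta> then b \<delta> else a \<delta>))"
        using dir(2)[of 0] pos by (auto simp: v_def)
    qed (use wt in auto)
  qed
  finally show ?thesis by (simp add: F_def)
qed

lemma chain_rule:
  fixes f :: "'x::ab_group_add \<Rightarrow> 'y::ab_group_add" and g :: "'z::ab_group_add \<Rightarrow> 'x"
  assumes "\<alpha> \<in> cube k"
  shows "mdiff k u \<alpha> (f \<circ> g) x = (\<Sum>\<xi>\<in>partitions k \<alpha>.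
    set_fdiffs (direction k u g x \<xi>) \<xi> f (direction k u g x \<xi> 0))"
  using assms
proof (induction k arbitrary: \<alpha> x)
  case 0
  have "cube 0 \<subseteq> {0}" by (auto simp: cube_iff fun_eq_iff)
  then have "partitions 0 \<alpha> = {{}}"
    using 0 by (auto simp: partitions_def)
  then show ?case by (simp add: mdiff_0 direction_def)
next
  case (Suc k)
  show ?case
  proof (cases "\<alpha> k = 0")
    case True
    then have \<alpha>: "\<alpha> \<in> cube k"
      using cube_upd_0[OF Suc.prems(1)] by (simp add: fun_upd_idem)
    have dir: "direction (Suc k) u g x \<xi> \<beta> = direction k u g x \<xi> \<beta>"
      if \<xi>: "\<xi> \<in> partitions k \<alpha>" and "\<beta> \<in> insert 0 \<xi>" for \<xi> \<beta>
    proof -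
      have "\<gamma> k = 0" if "\<gamma> \<in> chain_set k \<xi> \<beta>" for \<gamma>
        using proper_chains_partition[OF \<alpha> \<xi>] that \<open>\<beta> \<in> insert 0 \<xi>\<close> mbox_top
        unfolding proper_chains_def by blast
      then show ?thesis
        unfolding direction_def chain_set_Suc_top0[OF that] by (intro sum_mdiff_Suc)
    qed
    have "mdiff (Suc k) u \<alpha> (f \<circ> g) x = mdiff k u \<alpha> (f \<circ> g) x"
      using True by (simp add: mdiff_Suc_0)
    also have "\<dots> = (\<Sum>\<xi>\<in>partitions k \<alpha>.
        set_fdiffs (direction (Suc k) u g x \<xi>) \<xi> f (direction (Suc k) u g x \<xi> 0))"
      unfolding Suc.IH[OF \<alpha>]
    proof (rule sum.cong[OF refl])
      fix \<xi> assume \<xi>: "\<xi> \<in> partitions k \<alpha>"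
      have "set_fdiffs (direction k u g x \<xi>) \<xi> f = set_fdiffs (direction (Suc k) u g x \<xi>) \<xi> f"
        using dir[OF \<xi>] partitions_finite[OF \<xi>] by (intro set_fdiffs_cong) auto
      then show "set_fdiffs (direction k u g x \<xi>) \<xi> f (direction k u g x \<xi> 0) =
          set_fdiffs (direction (Suc k) u g x \<xi>) \<xi> f (direction (Suc k) u g x \<xi> 0)"
        using dir[OF \<xi>, of 0] by simp
    qed
    finally show ?thesis unfolding partitions_Suc_top0[of \<alpha> k, OF True] .
  next
    case False
    have "\<alpha> k \<le> 1" using Suc.prems(1) by (auto simp: cube_iff)
    then have 1: "\<alpha> k = 1" using False by simp
    define \<alpha>' where "\<alpha>' = \<alpha>(k := 0)"
    have \<alpha>': "\<alpha>' \<in> cube k" using cube_upd_0[OF Suc.prems(1)] by (simp add: \<alpha>'_def)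
    define T where "T \<xi> = set_fdiffs (direction (Suc k) u g x \<xi>) \<xi> f (direction (Suc k) u g x \<xi> 0)" for \<xi>
    have "mdiff (Suc k) u \<alpha> (f \<circ> g) x = mdiff k u \<alpha>' (f \<circ> g) (x + u k) - mdiff k u \<alpha>' (f \<circ> g) x"
      using mdiff_Suc_1[of \<alpha> k u "f \<circ> g"] 1 by (simp add: fdiff_def \<alpha>'_def)
    also have "\<dots> = (\<Sum>\<xi>\<in>partitions k \<alpha>'. \<Sum>\<delta>\<in>insert 0 \<xi>. T (extend k \<xi> \<delta>))"
      unfolding Suc.IH[OF \<alpha>'] sum_subtractf[symmetric] T_def
      by (intro sum.cong refl finite_difference_step[OF \<alpha>'])
    also have "\<dots> = (\<Sum>(\<xi>, \<delta>)\<in>(SIGMA \<xi>:partitions k \<alpha>'. insert 0 \<xi>). T (extend k \<xi> \<delta>))"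
      using partitions_finite by (intro sum.Sigma finite_partitions) auto
    also have "\<dots> = (\<Sum>\<xi>\<in>partitions (Suc k) \<alpha>. T \<xi>)"
      using sum.reindex_bij_betw[OF bij_betw_extend[OF Suc.prems(1) 1], of T, folded \<alpha>'_def]
      by (simp add: case_prod_unfold)
    finally show ?thesis unfolding T_def .
  qed
qed

theorem theoremB:
  fixes k :: nat and \<alpha> :: mindex
  assumes "k \<ge> 1" and "\<alpha> \<in> cube k" and "\<alpha> \<noteq> 0"
  shows
    "(\<forall>\<xi>\<in>partitions k \<alpha>.
        disjoint_family_on (chain_set k \<xi>) (insert 0 \<xi>) \<and>
        (\<forall>\<beta>\<in>insert 0 \<xi>. \<beta> \<in> chain_set k \<xi> \<beta> \<and> chain_set k \<xi> \<beta> \<subseteq> mbox k \<alpha>) \<and>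
        (\<forall>\<beta>\<in>insert 0 \<xi>. \<forall>\<gamma>\<in>chain_set k \<xi> \<beta> - {\<beta>}. msize k \<gamma> > msize k \<beta>)) \<and>
     (\<forall>(scaleX :: 'k::field \<Rightarrow> 'x::ab_group_add \<Rightarrow> 'x)
       (scaleY :: 'k \<Rightarrow> 'y::ab_group_add \<Rightarrow> 'y)
       (scaleZ :: 'k \<Rightarrow> 'z::ab_group_add \<Rightarrow> 'z)
       (f :: 'x \<Rightarrow> 'y) (g :: 'z \<Rightarrow> 'x) (u :: nat \<Rightarrow> 'z) (x :: 'z)
       (enum :: mindex set \<Rightarrow> mindex list).
        vector_space scaleX \<and> vector_space scaleY \<and> vector_space scaleZ \<and>
        (\<forall>\<xi>\<in>partitions k \<alpha>. distinct (enum \<xi>) \<and> set (enum \<xi>) = \<xi>) \<longrightarrow>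
        (let v = (\<lambda>\<xi> \<beta>. \<Sum>\<gamma>\<in>chain_set k \<xi> \<beta>. mdiff k u \<gamma> g x)
         in mdiff k u \<alpha> (f \<circ> g) x =
            (\<Sum>\<xi>\<in>partitions k \<alpha>. fdiffs (map (v \<xi>) (enum \<xi>)) f (v \<xi> 0))))"
proof (intro conjI)
  show "\<forall>\<xi>\<in>partitions k \<alpha>.
        disjoint_family_on (chain_set k \<xi>) (insert 0 \<xi>) \<and>
        (\<forall>\<beta>\<in>insert 0 \<xi>. \<beta> \<in> chain_set k \<xi> \<beta> \<and> chain_set k \<xi> \<beta> \<subseteq> mbox k \<alpha>) \<and>
        (\<forall>\<beta>\<in>insert 0 \<xi>. \<forall>\<gamma>\<in>chain_set k \<xi> \<beta> - {\<beta>}. msize k \<gamma> > msize k \<beta>)"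
    using proper_chains_partition[OF assms(2)] unfolding proper_chains_def by blast
next
  show "\<forall>(scaleX :: 'k \<Rightarrow> 'x \<Rightarrow> 'x) (scaleY :: 'k \<Rightarrow> 'y \<Rightarrow> 'y) (scaleZ :: 'k \<Rightarrow> 'z \<Rightarrow> 'z)
       (f :: 'x \<Rightarrow> 'y) (g :: 'z \<Rightarrow> 'x) (u :: nat \<Rightarrow> 'z) (x :: 'z)
       (enum :: mindex set \<Rightarrow> mindex list).
        vector_space scaleX \<and> vector_space scaleY \<and> vector_space scaleZ \<and>
        (\<forall>\<xi>\<in>partitions k \<alpha>. distinct (enum \<xi>) \<and> set (enum \<xi>) = \<xi>) \<longrightarrow>
        (let v = (\<lambda>\<xi> \<beta>. \<Sum>\<gamma>\<in>chain_set k \<xi> \<beta>. mdiff k u \<gamma> g x)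
         in mdiff k u \<alpha> (f \<circ> g) x =
            (\<Sum>\<xi>\<in>partitions k \<alpha>. fdiffs (map (v \<xi>) (enum \<xi>)) f (v \<xi> 0)))"
  proof (intro allI impI, unfold Let_def)
    fix f :: "'x \<Rightarrow> 'y" and g :: "'z \<Rightarrow> 'x" and u :: "nat \<Rightarrow> 'z" and x :: 'z
      and enum :: "mindex set \<Rightarrow> mindex list"
      and scaleX :: "'k \<Rightarrow> 'x \<Rightarrow> 'x" and scaleY :: "'k \<Rightarrow> 'y \<Rightarrow> 'y" and scaleZ :: "'k \<Rightarrow> 'z \<Rightarrow> 'z"
    assume "vector_space scaleX \<and> vector_space scaleY \<and> vector_space scaleZ \<and>
      (\<forall>\<xi>\<in>partitions k \<alpha>. distinct (enum \<xi>) \<and> set (enum \<xi>) = \<xi>)"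
    then have enum: "fdiffs (map w (enum \<xi>)) f = set_fdiffs w \<xi> f" if "\<xi> \<in> partitions k \<alpha>" for w \<xi>
      using that fdiffs_eq_set_fdiffs by metis
    show "mdiff k u \<alpha> (f \<circ> g) x = (\<Sum>\<xi>\<in>partitions k \<alpha>.
        fdiffs (map (\<lambda>\<beta>. \<Sum>\<gamma>\<in>chain_set k \<xi> \<beta>. mdiff k u \<gamma> g x) (enum \<xi>)) f
          (\<Sum>\<gamma>\<in>chain_set k \<xi> 0. mdiff k u \<gamma> g x))"
      unfolding chain_rule[OF assms(2)] direction_def
      by (intro sum.cong refl) (simp add: enum)
  qed
qed

end
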